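(* There is an algorithm that, given positive real numbers $\ell_1,\dots,\ell_n$ (the lengths of the $n$ segments of a carpenter's ruler), computes in $O(n)$ time the shortest length into which the ruler can be wrapped, i.e. the quantity \[ W(\ell_1,\dots,\ell_n)=\min \max(t_1,\dots,t_m), \] where the minimum ranges over all $m\ge 1$ and all partitions of the sequence $\ell_1,\dots,\ell_n$ into $m$ nonempty consecutive blocks with block sums $t_1,\dots,t_m$ satisfying $t_1\le t_2\le\cdots\le t_{m-1}$ (no constraint is placed on $t_m$).
   Context: A carpenter's ruler consists of $n$ segments of given positive lengths $\ell_1,\dots,\ell_n$ joined end to end by hinges; segments have width $0$ and folds are points. Wrapping the ruler means folding some subset of the hinges by 180 degrees, all in the same rotational direction (all clockwise or all counter-clockwise), so that the ruler lies on a line; the length of the wrapping is the length of the interval it occupies. If the folded hinges split the ruler into consecutive pieces of total lengths $t_1,\dots,t_m$ (from one end to the other), such a same-direction wrapping exists exactly when $t_1\le t_2\le\cdots\le t_{m-1}$ (the last piece may be shorter, in which case it lies inside the previous turn), and its length is then $\max(t_1,\dots,t_m)$. Running times are in a model where arithmetic operations and comparisons on the input numbers take constant time. *)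

theory Defs
  imports Complex_Main "HOL-Library.Landau_Symbols"
begin

subsection \<open>Wrapping a ruler\<close>

definition ruler :: "real list \<Rightarrow> bool" where
  "ruler ls \<longleftrightarrow> ls \<noteq> [] \<and> (\<forall>l \<in> set ls. l > 0)"

text \<open>A wrapping is given by its list of consecutive blocks of segments; the condition on the
  block sums \<open>t\<^sub>1, \<dots>, t\<^sub>m\<close> concerns all of them but the last.\<close>

definition wrappings :: "real list \<Rightarrow> real list list set" where
  "wrappings ls =
     {bs. bs \<noteq> [] \<and> (\<forall>b \<in> set bs. b \<noteq> []) \<and> concat bs = ls \<and> sorted (butlast (map sum_list bs))}"

definition wrap_length :: "real list list \<Rightarrow> real" where
  "wrap_length bs = Max (set (map sum_list bs))"

definition W :: "real list \<Rightarrow> real" where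
  "W ls = Min (wrap_length ` wrappings ls)"

text \<open>The minimum is over a finite nonempty set, so that \<^const>\<open>Min\<close> is meaningful.\<close>

lemma length_le_length_concat:
  "\<forall>b \<in> set bs. b \<noteq> [] \<Longrightarrow> length bs \<le> length (concat bs)"
proof (induction bs)
  case (Cons b bs)
  then have "length b \<ge> 1" by (simp add: Suc_le_eq)
  with Cons show ?case by simp
qed simp

lemma finite_wrappings: "finite (wrappings ls)"
proof (rule finite_subset)
  let ?B = "{b. set b \<subseteq> set ls \<and> length b \<le> length ls}"
  show "finite {bs. set bs \<subseteq> ?B \<and> length bs \<le> length ls}"
    by (intro finite_lists_length_le) simp
  show "wrappings ls \<subseteq> {bs. set bs \<subseteq> ?B \<and> length bs \<le> length ls}"
  proof
    fix bs assume bs: "bs \<in> wrappings ls"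
    have "length b \<le> length (concat bs)" if "b \<in> set bs" for b
      using that by (induction bs) auto
    with bs length_le_length_concat[of bs]
    show "bs \<in> {bs. set bs \<subseteq> ?B \<and> length bs \<le> length ls}"
      by (auto simp: wrappings_def)
  qed
qed

lemma wrappings_nonempty: "ls \<noteq> [] \<Longrightarrow> wrappings ls \<noteq> {}"
  by (auto simp: wrappings_def intro!: exI[of _ "[ls]"])


subsection \<open>A real RAM\<close>

text \<open>
  Running times refer to a two-sorted random access machine: natural numbers serve as indices and
  counters, real numbers hold the data. Both sorts have scalar variables and unbounded arrays with
  random access. Reals are accessible only through the field operations and comparisons, and
  cannot be converted to natural numbers; the only real constants are 0 and 1. Naturals can only be
  added, subtracted and compared. Every constant, variable access, array access, arithmetic
  operation, comparison, Boolean operation, store and branch costs one unit of time.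
\<close>

type_synonym vname = string

record state =
  nvar :: "vname \<Rightarrow> nat"
  rvar :: "vname \<Rightarrow> real"
  narr :: "vname \<Rightarrow> nat \<Rightarrow> nat"
  rarr :: "vname \<Rightarrow> nat \<Rightarrow> real"

datatype nexp =
    NConst nat
  | NVar vname
  | NArr vname nexp
  | NAdd nexp nexp
  | NSub nexp nexp

datatype rexp =
    RZero
  | ROne
  | RVar vname
  | RArr vname nexp
  | RAdd rexp rexp
  | RSub rexp rexp
  | RMul rexp rexp
  | RDiv rexp rexp

datatype bexp =
    NLess nexp nexp
  | RLess rexp rexp
  | BNot bexp
  | BAnd bexp bexp

datatype com =
    Skip
  | NAssign vname nexp
  | RAssign vname rexp
  | NStore vname nexp nexp
  | RStore vname nexp rexp
  | Seq com com
  | Cond bexp com com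
  | While bexp com

primrec nval :: "nexp \<Rightarrow> state \<Rightarrow> nat" where
  "nval (NConst k) s = k"
| "nval (NVar x) s = nvar s x"
| "nval (NArr a i) s = narr s a (nval i s)"
| "nval (NAdd e f) s = nval e s + nval f s"
| "nval (NSub e f) s = nval e s - nval f s"

primrec rval :: "rexp \<Rightarrow> state \<Rightarrow> real" where
  "rval RZero s = 0"
| "rval ROne s = 1"
| "rval (RVar x) s = rvar s x"
| "rval (RArr a i) s = rarr s a (nval i s)"
| "rval (RAdd e f) s = rval e s + rval f s"
| "rval (RSub e f) s = rval e s - rval f s"
| "rval (RMul e f) s = rval e s * rval f s"
| "rval (RDiv e f) s = rval e s / rval f s"

primrec bval :: "bexp \<Rightarrow> state \<Rightarrow> bool" where
  "bval (NLess e f) s \<longleftrightarrow> nval e s < nval f s"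
| "bval (RLess e f) s \<longleftrightarrow> rval e s < rval f s"
| "bval (BNot b) s \<longleftrightarrow> \<not> bval b s"
| "bval (BAnd b c) s \<longleftrightarrow> bval b s \<and> bval c s"

primrec ncost :: "nexp \<Rightarrow> nat" where
  "ncost (NConst k) = 1"
| "ncost (NVar x) = 1"
| "ncost (NArr a i) = ncost i + 1"
| "ncost (NAdd e f) = ncost e + ncost f + 1"
| "ncost (NSub e f) = ncost e + ncost f + 1"

primrec rcost :: "rexp \<Rightarrow> nat" where
  "rcost RZero = 1"
| "rcost ROne = 1"
| "rcost (RVar x) = 1"
| "rcost (RArr a i) = ncost i + 1"
| "rcost (RAdd e f) = rcost e + rcost f + 1"
| "rcost (RSub e f) = rcost e + rcost f + 1"
| "rcost (RMul e f) = rcost e + rcost f + 1"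
| "rcost (RDiv e f) = rcost e + rcost f + 1"

primrec bcost :: "bexp \<Rightarrow> nat" where
  "bcost (NLess e f) = ncost e + ncost f + 1"
| "bcost (RLess e f) = rcost e + rcost f + 1"
| "bcost (BNot b) = bcost b + 1"
| "bcost (BAnd b c) = bcost b + bcost c + 1"

text \<open>\<open>exec c s t s'\<close>: started in \<open>s\<close>, the program \<open>c\<close> terminates in \<open>s'\<close> after \<open>t\<close> units of time.\<close>

inductive exec :: "com \<Rightarrow> state \<Rightarrow> nat \<Rightarrow> state \<Rightarrow> bool" where
  Skip: "exec Skip s 1 s"
| NAssign: "exec (NAssign x e) s (ncost e + 1) (s\<lparr>nvar := (nvar s)(x := nval e s)\<rparr>)"
| RAssign: "exec (RAssign x e) s (rcost e + 1) (s\<lparr>rvar := (rvar s)(x := rval e s)\<rparr>)"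
| NStore: "exec (NStore a i e) s (ncost i + ncost e + 1)
    (s\<lparr>narr := (narr s)(a := (narr s a)(nval i s := nval e s))\<rparr>)"
| RStore: "exec (RStore a i e) s (ncost i + rcost e + 1)
    (s\<lparr>rarr := (rarr s)(a := (rarr s a)(nval i s := rval e s))\<rparr>)"
| Seq: "exec c s t s' \<Longrightarrow> exec d s' u s'' \<Longrightarrow> exec (Seq c d) s (t + u) s''"
| CondTrue: "bval b s \<Longrightarrow> exec c s t s' \<Longrightarrow> exec (Cond b c d) s (bcost b + t + 1) s'"
| CondFalse: "\<not> bval b s \<Longrightarrow> exec d s t s' \<Longrightarrow> exec (Cond b c d) s (bcost b + t + 1) s'"
| WhileFalse: "\<not> bval b s \<Longrightarrow> exec (While b c) s (bcost b + 1) s"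
| WhileTrue: "bval b s \<Longrightarrow> exec c s t s' \<Longrightarrow> exec (While b c) s' u s'' \<Longrightarrow>
    exec (While b c) s (bcost b + t + u + 1) s''"

inductive_cases exec_elims:
  "exec Skip s t s'" "exec (NAssign x e) s t s'" "exec (RAssign x r) s t s'"
  "exec (NStore a i e) s t s'" "exec (RStore a i r) s t s'" "exec (Seq c d) s t s'"
  "exec (Cond b c d) s t s'" "exec (While b c) s t s'"

lemma exec_deterministic: "exec c s t s' \<Longrightarrow> exec c s t2 s2 \<Longrightarrow> t2 = t \<and> s2 = s'"
proof (induction arbitrary: t2 s2 rule: exec.induct)
  case (Seq c s t s' d u s'')
  from Seq.prems obtain t1 s1 u1 where
    "t2 = t1 + u1" "exec c s t1 s1" "exec d s1 u1 s2" by (rule exec_elims(6))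
  with Seq.IH show ?case by metis
next
  case (CondTrue b s c t s' d)
  from CondTrue.prems CondTrue.hyps obtain t1 where
    "t2 = bcost b + t1 + 1" "exec c s t1 s2" by (auto elim: exec_elims(7))
  with CondTrue.IH show ?case by metis
next
  case (CondFalse b s d t s' c)
  from CondFalse.prems CondFalse.hyps obtain t1 where
    "t2 = bcost b + t1 + 1" "exec d s t1 s2" by (auto elim: exec_elims(7))
  with CondFalse.IH show ?case by metis
next
  case (WhileFalse b s c)
  from WhileFalse.prems show ?case by (rule exec_elims(8)) (use WhileFalse.hyps in simp_all)
next
  case (WhileTrue b s c t s' u s'')
  from WhileTrue.prems obtain t1 s1 u1 where
    "t2 = bcost b + t1 + u1 + 1" "exec c s t1 s1" "exec (While b c) s1 u1 s2"
    by (rule exec_elims(8)) (use WhileTrue.hyps in simp_all)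
  with WhileTrue.IH show ?case by metis
qed (erule exec_elims(1-5); simp)+

text \<open>The input array is indexed from 0; all memory not holding the input is initially 0.\<close>

definition initial :: "real list \<Rightarrow> state" where
  "initial ls = \<lparr>nvar = (\<lambda>_. 0)(''n'' := length ls),
                 rvar = (\<lambda>_. 0),
                 narr = (\<lambda>_ _. 0),
                 rarr = (\<lambda>_ _. 0)(''input'' := (\<lambda>i. if i < length ls then ls ! i else 0))\<rparr>"

definition result_of :: "state \<Rightarrow> real" where
  "result_of s = rvar s ''output''"

end

theory Submission
  imports Defs
begin

text \<open>
  Let \<open>S j\<close> be the sum of the first \<open>j\<close> segments and \<open>g j\<close> the least possible last block sum of a
  partition of these segments into blocks with nondecreasing sums. A last block starting at
  position \<open>i\<close> is admissible for \<open>j\<close> iff \<open>S i + g i \<le> S j\<close>, hence \<open>g j = S j - S i\<close> for the largest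
  such \<open>i < j\<close>, and \<open>W\<close> is the minimum of \<open>max (g i) (S n - S i)\<close> over \<open>i < n\<close>. As \<open>S\<close> increases, an
  \<open>i\<close> stays admissible once it is so, and \<open>i\<close> is useless if a later position has a key \<open>S i + g i\<close> that
  is not larger. A queue of positions with strictly increasing keys therefore finds all the
  optimal \<open>i\<close>; every position is inserted once and removed at most once.
\<close>

subsection \<open>Partitions with nondecreasing block sums\<close>

definition prefix_sum :: "real list \<Rightarrow> nat \<Rightarrow> real" where
  "prefix_sum ls j = sum_list (take j ls)"

definition sorted_partitions :: "real list \<Rightarrow> real list list set" where
  "sorted_partitions ls = {bs. (\<forall>b \<in> set bs. b \<noteq> []) \<and> concat bs = ls \<and> sorted (map sum_list bs)}"

text \<open>The value 0 for the empty partition gives position 0 the key 0, so a single block is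
  always admissible.\<close>

definition last_sum :: "real list list \<Rightarrow> real" where
  "last_sum bs = (if bs = [] then 0 else sum_list (last bs))"

definition min_last :: "real list \<Rightarrow> nat \<Rightarrow> real" where
  "min_last ls j = Min (last_sum ` sorted_partitions (take j ls))"

definition key :: "real list \<Rightarrow> nat \<Rightarrow> real" where
  "key ls j = prefix_sum ls j + min_last ls j"

section \<open>Prefix sums and block sums\<close>

lemma prefix_sum_0 [simp]: "prefix_sum ls 0 = 0"
  by (simp add: prefix_sum_def)

lemma prefix_sum_Suc: "j < length ls \<Longrightarrow> prefix_sum ls (Suc j) = prefix_sum ls j + ls ! j"
  by (simp add: prefix_sum_def take_Suc_conv_app_nth)

lemma prefix_sum_less:
  assumes "ruler ls" "i < j" "j \<le> length ls"
  shows "prefix_sum ls i < prefix_sum ls j"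
  using assms(2,3)
proof (induction j)
  case (Suc j)
  then have "ls ! j > 0" using assms(1) by (simp add: ruler_def)
  with Suc show ?case
    by (cases "i = j") (auto simp: prefix_sum_Suc)
qed simp

lemma sum_list_positive:
  fixes xs :: "real list"
  shows "xs \<noteq> [] \<Longrightarrow> (\<And>x. x \<in> set xs \<Longrightarrow> 0 < x) \<Longrightarrow> 0 < sum_list xs"
proof (induction xs rule: list_nonempty_induct)
  case (cons x xs)
  then have "0 < x" "0 < sum_list xs" by auto
  then show ?case by simp
qed simp

lemma sum_list_take_drop: "i \<le> j \<Longrightarrow> sum_list (take (j - i) (drop i ls)) = prefix_sum ls j - prefix_sum ls i"
proof -
  assume "i \<le> j"
  then have "take j ls = take i ls @ take (j - i) (drop i ls)"
    by (metis le_add_diff_inverse take_add)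
  then show ?thesis by (simp add: prefix_sum_def)
qed

section \<open>Sorted partitions of prefixes and the recurrence for the minimal last sum\<close>

lemma sorted_partitions_subset: "ls \<noteq> [] \<Longrightarrow> sorted_partitions ls \<subseteq> wrappings ls"
  by (auto simp: sorted_partitions_def wrappings_def map_butlast sorted_butlast)

lemma sorted_partitions_Nil [simp]: "sorted_partitions [] = {[]}"
  by (auto simp: sorted_partitions_def)

lemma finite_sorted_partitions: "finite (sorted_partitions ls)"
  by (cases "ls = []") (auto intro: finite_subset[OF sorted_partitions_subset finite_wrappings])

lemma sorted_partitions_nonempty: "sorted_partitions ls \<noteq> {}"
proof (cases "ls = []")
  case False
  then have "[ls] \<in> sorted_partitions ls" by (simp add: sorted_partitions_def)
  then show ?thesis by blast
qed simp

lemma min_last_0 [simp]: "min_last ls 0 = 0"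
  by (simp add: min_last_def last_sum_def)

lemma min_last_le: "bs \<in> sorted_partitions (take j ls) \<Longrightarrow> min_last ls j \<le> last_sum bs"
  by (simp add: min_last_def finite_sorted_partitions)

lemma min_last_attained:
  obtains bs where "bs \<in> sorted_partitions (take j ls)" "last_sum bs = min_last ls j"
proof -
  have "min_last ls j \<in> last_sum ` sorted_partitions (take j ls)"
    unfolding min_last_def
    by (intro Min_in) (simp_all add: finite_sorted_partitions sorted_partitions_nonempty)
  with that show thesis by auto
qed

lemma last_sum_upper:
  assumes "sorted (map sum_list bs)" "b \<in> set bs"
  shows "sum_list b \<le> last_sum bs"
proof -
  from assms(2) obtain cs c where bs: "bs = cs @ [c]" by (cases bs rule: rev_cases) auto
  with assms show ?thesis by (auto simp: last_sum_def sorted_append)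
qed

lemma sorted_partitions_snoc:
  assumes "i < j" "j \<le> length ls" "cs \<in> sorted_partitions (take i ls)"
    "last_sum cs \<le> prefix_sum ls j - prefix_sum ls i"
  shows "cs @ [take (j - i) (drop i ls)] \<in> sorted_partitions (take j ls)"
proof -
  have "take j ls = take i ls @ take (j - i) (drop i ls)"
    using assms(1) by (metis le_add_diff_inverse less_imp_le take_add)
  moreover have "sum_list b \<le> prefix_sum ls j - prefix_sum ls i" if "b \<in> set cs" for b
    using last_sum_upper[of cs b] that assms(3,4) by (simp add: sorted_partitions_def)
  ultimately show ?thesis
    using assms(1-3) by (simp add: sorted_partitions_def sorted_append sum_list_take_drop)
qed

text \<open>Translates the last block into its starting position. Sortedness is not assumed, so this
  serves sorted partitions and wrappings alike.\<close>

lemma snoc_partition_split: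
  assumes "concat (cs @ [b]) = take j ls" "b \<noteq> []" "j \<le> length ls"
  obtains i where "i < j" "concat cs = take i ls" "b = take (j - i) (drop i ls)"
proof
  let ?i = "length (concat cs)"
  have eq: "concat cs @ b = take j ls" using assms(1) by simp
  then have len: "?i + length b = j" using assms(3)
    by (metis length_append length_take min.absorb2)
  then show "?i < j" using assms(2) by (cases b) auto
  show "concat cs = take ?i ls"
    using arg_cong[OF eq, of "take ?i"] len by (simp add: min_def split: if_splits)
  show "b = take (j - ?i) (drop ?i ls)"
    using arg_cong[OF eq, of "drop ?i"] by (simp add: drop_take)
qed

text \<open>The assumptions make \<open>i\<close> the largest admissible position. Extending an
  optimal partition of the first \<open>i\<close> segments gives one inequality. For the other, the
  last block of any optimal partition starts at an admissible \<open>k\<close>, hence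
  \<open>k \<le> i\<close>, and prefix sums increase.\<close>

lemma min_last_eq:
  assumes "ruler ls" "i < j" "j \<le> length ls" "key ls i \<le> prefix_sum ls j"
    and max: "\<And>k. i < k \<Longrightarrow> k < j \<Longrightarrow> prefix_sum ls j < key ls k"
  shows "min_last ls j = prefix_sum ls j - prefix_sum ls i"
proof (rule antisym)
  obtain cs where cs: "cs \<in> sorted_partitions (take i ls)" "last_sum cs = min_last ls i"
    by (rule min_last_attained)
  with assms have "cs @ [take (j - i) (drop i ls)] \<in> sorted_partitions (take j ls)"
    by (intro sorted_partitions_snoc) (auto simp: key_def)
  from min_last_le[OF this] show "min_last ls j \<le> prefix_sum ls j - prefix_sum ls i"
    using assms(2) by (simp add: last_sum_def sum_list_take_drop)
next
  obtain bs where bs: "bs \<in> sorted_partitions (take j ls)" "last_sum bs = min_last ls j"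
    by (rule min_last_attained)
  have "take j ls \<noteq> []" using assms by auto
  with bs have "bs \<noteq> []" by (auto simp: sorted_partitions_def)
  then obtain cs b where bs_eq: "bs = cs @ [b]" by (metis rev_exhaust)
  with bs have "concat (cs @ [b]) = take j ls" "b \<noteq> []"
    by (auto simp: sorted_partitions_def)
  from snoc_partition_split[OF this assms(3)] obtain k where
    k: "k < j" "concat cs = take k ls" "b = take (j - k) (drop k ls)" .
  then have b: "sum_list b = prefix_sum ls j - prefix_sum ls k" by (simp add: sum_list_take_drop)
  have cs: "cs \<in> sorted_partitions (take k ls)"
    using bs bs_eq k by (auto simp: sorted_partitions_def sorted_append)
  have "last_sum cs \<le> sum_list b"
  proof (cases "cs = []")
    case True
    with k b assms prefix_sum_less[of ls k j] show ?thesis by (simp add: last_sum_def)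
  next
    case False
    with bs bs_eq show ?thesis by (auto simp: sorted_partitions_def sorted_append last_sum_def)
  qed
  with min_last_le[OF cs] b have "key ls k \<le> prefix_sum ls j" by (simp add: key_def)
  with max[of k] k have "k \<le> i" by force
  then have "prefix_sum ls k \<le> prefix_sum ls i"
    using prefix_sum_less[of ls k i] assms by (cases "k = i") auto
  with b bs bs_eq show "prefix_sum ls j - prefix_sum ls i \<le> min_last ls j"
    by (simp add: last_sum_def)
qed

text \<open>The last block of an optimal partition is nonempty, so its sum is positive. This later
  shows that a position whose key is at least that of \<open>j\<close> is not admissible for
  \<open>j\<close>.\<close>

lemma prefix_sum_less_key:
  assumes "ruler ls" "0 < j" "j \<le> length ls"
  shows "prefix_sum ls j < key ls j"
proof -
  obtain bs where bs: "bs \<in> sorted_partitions (take j ls)" "last_sum bs = min_last ls j"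
    by (rule min_last_attained)
  have "take j ls \<noteq> []" using assms by auto
  with bs have ne: "bs \<noteq> []" by (auto simp: sorted_partitions_def)
  have "set (last bs) \<subseteq> set (concat bs)" using last_in_set[OF ne] by auto
  with bs last_in_set[OF ne] have "last bs \<noteq> []" "set (last bs) \<subseteq> set ls"
    using set_take_subset[of j ls] by (auto simp: sorted_partitions_def)
  then have "0 < sum_list (last bs)"
    using assms(1) by (intro sum_list_positive) (auto simp: ruler_def)
  with bs ne show ?thesis by (simp add: key_def last_sum_def)
qed

section \<open>Reduction of \<open>W\<close> to a minimum over the start of the final block\<close>

definition wrap_bound :: "real list \<Rightarrow> nat \<Rightarrow> real" where
  "wrap_bound ls i = max (min_last ls i) (prefix_sum ls (length ls) - prefix_sum ls i)"

text \<open>The largest of the sorted sums is the last one; nonnegativity of the final sum covers an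
  empty \<open>cs\<close>, where \<open>last_sum\<close> is 0.\<close>

lemma wrap_length_snoc:
  assumes "sorted (map sum_list cs)" "0 \<le> sum_list b"
  shows "wrap_length (cs @ [b]) = max (last_sum cs) (sum_list b)"
proof (cases "cs = []")
  case True
  with assms show ?thesis by (simp add: wrap_length_def last_sum_def)
next
  case False
  with assms(1) have "Max (sum_list ` set cs) = last_sum cs"
    by (intro Max_eqI) (auto simp: last_sum_upper, simp add: last_sum_def)
  with False show ?thesis by (simp add: wrap_length_def max.commute)
qed

text \<open>The final block is unconstrained, so any sorted partition of the first \<open>i\<close>
  segments may precede it, and only the last sum of that partition affects the length.\<close>

lemma W_eq:
  assumes "ruler ls"
  shows "W ls = Min (wrap_bound ls ` {..<length ls})"
proof (rule antisym)
  have ne: "wrappings ls \<noteq> {}" and len: "length ls > 0"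
    using assms wrappings_nonempty by (auto simp: ruler_def)
  show "W ls \<le> Min (wrap_bound ls ` {..<length ls})"
  proof (rule Min.boundedI)
    fix a assume "a \<in> wrap_bound ls ` {..<length ls}"
    then obtain i where i: "i < length ls" "a = wrap_bound ls i" by auto
    obtain cs where cs: "cs \<in> sorted_partitions (take i ls)" "last_sum cs = min_last ls i"
      by (rule min_last_attained)
    have b: "sum_list (drop i ls) = prefix_sum ls (length ls) - prefix_sum ls i"
      using sum_list_take_drop[of i "length ls" ls] i by simp
    have "cs @ [drop i ls] \<in> wrappings ls"
      using cs i by (auto simp: wrappings_def sorted_partitions_def)
    moreover have "wrap_length (cs @ [drop i ls]) = a"
      using cs i b prefix_sum_less[OF assms i(1)]
      by (subst wrap_length_snoc) (auto simp: sorted_partitions_def wrap_bound_def)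
    ultimately show "W ls \<le> a"
      unfolding W_def by (metis Min_le finite_imageI finite_wrappings imageI)
  qed (use len in auto)
  show "Min (wrap_bound ls ` {..<length ls}) \<le> W ls"
    unfolding W_def
  proof (rule Min.boundedI)
    fix a assume "a \<in> wrap_length ` wrappings ls"
    then obtain bs where bs: "bs \<in> wrappings ls" "a = wrap_length bs" by auto
    then have "bs \<noteq> []" by (simp add: wrappings_def)
    then obtain cs b where bs_eq: "bs = cs @ [b]" by (metis rev_exhaust)
    with bs have "concat (cs @ [b]) = take (length ls) ls" "b \<noteq> []"
      by (auto simp: wrappings_def)
    from snoc_partition_split[OF this] obtain i where
      i: "i < length ls" "concat cs = take i ls" "b = take (length ls - i) (drop i ls)" by auto
    have b: "sum_list b = prefix_sum ls (length ls) - prefix_sum ls i"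
      using i by (simp add: sum_list_take_drop del: take_all_iff take_all)
    have cs: "cs \<in> sorted_partitions (take i ls)"
      using bs bs_eq i by (auto simp: sorted_partitions_def wrappings_def)
    have "a = max (last_sum cs) (sum_list b)"
      using bs bs_eq cs b prefix_sum_less[OF assms i(1)]
      by (auto simp: sorted_partitions_def wrap_length_snoc)
    then have "wrap_bound ls i \<le> a"
      using b min_last_le[OF cs] by (auto simp: wrap_bound_def)
    then show "Min (wrap_bound ls ` {..<length ls}) \<le> a"
      using i by (intro Min.coboundedI[THEN order_trans]) auto
  qed (use ne finite_wrappings in auto)
qed


subsection \<open>Loop-free programs and loops over them\<close>

text \<open>On this fragment execution is a total function with a time bound independent of the
  state, so loop bodies can be evaluated by simplification.\<close>

primrec loop_free :: "com \<Rightarrow> bool" where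
  "loop_free Skip = True"
| "loop_free (NAssign x e) = True"
| "loop_free (RAssign x e) = True"
| "loop_free (NStore a i e) = True"
| "loop_free (RStore a i e) = True"
| "loop_free (Seq c d) = (loop_free c \<and> loop_free d)"
| "loop_free (Cond b c d) = (loop_free c \<and> loop_free d)"
| "loop_free (While b c) = False"

text \<open>The values of \<open>effect\<close> and \<open>cost_bound\<close> on loops are irrelevant.\<close>

primrec effect :: "com \<Rightarrow> state \<Rightarrow> state" where
  "effect Skip s = s"
| "effect (NAssign x e) s = s\<lparr>nvar := (nvar s)(x := nval e s)\<rparr>"
| "effect (RAssign x e) s = s\<lparr>rvar := (rvar s)(x := rval e s)\<rparr>"
| "effect (NStore a i e) s = s\<lparr>narr := (narr s)(a := (narr s a)(nval i s := nval e s))\<rparr>"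
| "effect (RStore a i e) s = s\<lparr>rarr := (rarr s)(a := (rarr s a)(nval i s := rval e s))\<rparr>"
| "effect (Seq c d) s = effect d (effect c s)"
| "effect (Cond b c d) s = (if bval b s then effect c s else effect d s)"
| "effect (While b c) s = s"

primrec cost_bound :: "com \<Rightarrow> nat" where
  "cost_bound Skip = 1"
| "cost_bound (NAssign x e) = ncost e + 1"
| "cost_bound (RAssign x e) = rcost e + 1"
| "cost_bound (NStore a i e) = ncost i + ncost e + 1"
| "cost_bound (RStore a i e) = ncost i + rcost e + 1"
| "cost_bound (Seq c d) = cost_bound c + cost_bound d"
| "cost_bound (Cond b c d) = bcost b + max (cost_bound c) (cost_bound d) + 1"
| "cost_bound (While b c) = 0"

lemma exec_loop_free: "loop_free c \<Longrightarrow> \<exists>t \<le> cost_bound c. exec c s t (effect c s)"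
proof (induction c arbitrary: s)
  case (Seq c d)
  then obtain t u where "t \<le> cost_bound c" "exec c s t (effect c s)"
    "u \<le> cost_bound d" "exec d (effect c s) u (effect d (effect c s))" by fastforce
  then show ?case by (auto intro!: exI[of _ "t + u"] exec.Seq)
next
  case (Cond b c d)
  then obtain t u where "t \<le> cost_bound c" "exec c s t (effect c s)"
    "u \<le> cost_bound d" "exec d s u (effect d s)" by fastforce
  then show ?case
    using exec.CondTrue[of b s c t "effect c s" d] exec.CondFalse[of b s d u "effect d s" c]
    by (intro exI[of _ "bcost b + (if bval b s then t else u) + 1"]) auto
qed (force intro: exec.intros[simplified])+

text \<open>A total correctness rule with time: the measure bounds the number of iterations, and the
  last summand pays for the failing test.\<close>

lemma exec_While:
  fixes measure :: "state \<Rightarrow> nat"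
  assumes "loop_free c" "I s"
    and step: "\<And>s. I s \<Longrightarrow> bval b s \<Longrightarrow> I (effect c s) \<and> measure (effect c s) < measure s"
  shows "\<exists>t s'. exec (While b c) s t s' \<and> I s' \<and> \<not> bval b s' \<and>
    t \<le> measure s * (bcost b + cost_bound c + 1) + bcost b + 1"
  using assms(2)
proof (induction "measure s" arbitrary: s rule: less_induct)
  case less
  show ?case
  proof (cases "bval b s")
    case False
    with less.prems show ?thesis
      by (intro exI[of _ "bcost b + 1"] exI[of _ s]) (auto intro: exec.WhileFalse[simplified])
  next
    case True
    let ?K = "bcost b + cost_bound c + 1" and ?s = "effect c s"
    from step[OF less.prems True] have st: "I ?s" "measure ?s < measure s" by auto
    from less.hyps[OF st(2,1)] obtain u s' where
      u: "exec (While b c) ?s u s'" "I s'" "\<not> bval b s'" "u \<le> measure ?s * ?K + bcost b + 1"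
      by blast
    obtain t where t: "t \<le> cost_bound c" "exec c s t ?s"
      using exec_loop_free[OF assms(1)] by blast
    \<comment> \<open>The drop of the measure by at least 1 pays for this iteration.\<close>
    have "(measure ?s + 1) * ?K \<le> measure s * ?K" using st(2) by (intro mult_le_mono) auto
    with t(1) u(4) have "bcost b + t + u + 1 \<le> measure s * ?K + bcost b + 1"
      by (simp add: algebra_simps)
    with exec.WhileTrue[OF True t(2) u(1)] u(2,3) show ?thesis by blast
  qed
qed


subsection \<open>The algorithm\<close>

definition sum_test :: bexp where
  "sum_test = NLess (NVar ''i'') (NVar ''n'')"

definition sum_body :: com where
  "sum_body =
     Seq (RAssign ''total'' (RAdd (RVar ''total'') (RArr ''input'' (NVar ''i''))))
         (NAssign ''i'' (NAdd (NVar ''i'') (NConst 1)))"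

text \<open>The queue becomes the single position 0. The zeros initially in \<open>h\<close>,
  \<open>q\<close>, \<open>P\<close> and \<open>V\<close> are already its correct data, and
  \<open>output\<close> is the length of the ruler as one block.\<close>

definition start :: com where
  "start =
     Seq (NAssign ''t'' (NConst 1))
    (Seq (NAssign ''j'' (NConst 1))
    (Seq (RAssign ''x'' (RArr ''input'' (NConst 0)))
         (RAssign ''output'' (RVar ''total''))))"

definition queue_test :: bexp where
  "queue_test = NLess (NVar ''j'') (NVar ''n'')"

text \<open>With \<open>x\<close> the prefix sum at \<open>j\<close>, this asks whether the second
  entry is admissible too; if so, it supersedes the front for good.\<close>

definition skip_test :: bexp where
  "skip_test =
     BAnd (NLess (NAdd (NVar ''h'') (NConst 1)) (NVar ''t''))
          (BNot (RLess (RVar ''x'') (RArr ''V'' (NArr ''q'' (NAdd (NVar ''h'') (NConst 1))))))"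

text \<open>With \<open>v\<close> the key of \<open>j\<close>, the back is useless if its key is not
  smaller. The front never passes this test, since its key is at most \<open>x\<close> and
  \<open>x\<close> is less than \<open>v\<close>.\<close>

definition pop_test :: bexp where
  "pop_test = BNot (RLess (RArr ''V'' (NArr ''q'' (NSub (NVar ''t'') (NConst 1)))) (RVar ''v''))"

text \<open>Here \<open>v - x\<close> is the minimal last sum at \<open>j\<close>, so
  \<open>c\<close> is \<open>wrap_bound\<close> at \<open>j\<close>.\<close>

definition push :: com where
  "push =
     Seq (NStore ''q'' (NVar ''t'') (NVar ''j''))
    (Seq (RStore ''P'' (NVar ''j'') (RVar ''x''))
    (Seq (RStore ''V'' (NVar ''j'') (RVar ''v''))
    (Seq (NAssign ''t'' (NAdd (NVar ''t'') (NConst 1)))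
    (Seq (Cond (RLess (RSub (RVar ''v'') (RVar ''x'')) (RSub (RVar ''total'') (RVar ''x'')))
            (RAssign ''c'' (RSub (RVar ''total'') (RVar ''x'')))
            (RAssign ''c'' (RSub (RVar ''v'') (RVar ''x''))))
    (Seq (Cond (RLess (RVar ''c'') (RVar ''output'')) (RAssign ''output'' (RVar ''c'')) Skip)
    (Seq (RAssign ''x'' (RAdd (RVar ''x'') (RArr ''input'' (NVar ''j''))))
         (NAssign ''j'' (NAdd (NVar ''j'') (NConst 1)))))))))"

text \<open>The queue is \<open>q[h], \<dots>, q[t - 1]\<close>, and \<open>P\<close> and \<open>V\<close> hold the prefix sums and keys. Doing a
  single queue operation per iteration avoids nested loops.\<close>

definition queue_body :: com where
  "queue_body =
     Cond skip_test (NAssign ''h'' (NAdd (NVar ''h'') (NConst 1)))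
    (Seq (RAssign ''v'' (RAdd (RVar ''x'')
            (RSub (RVar ''x'') (RArr ''P'' (NArr ''q'' (NVar ''h''))))))
         (Cond pop_test (NAssign ''t'' (NSub (NVar ''t'') (NConst 1))) push))"

section \<open>The whole program, its loop invariants and the potential\<close>

definition wrap_prog :: com where
  "wrap_prog = Seq (While sum_test sum_body) (Seq start (While queue_test queue_body))"

text \<open>The state is fixed completely because \<open>start\<close> relies on other memory still
  being 0.\<close>

definition sum_inv :: "real list \<Rightarrow> state \<Rightarrow> bool" where
  "sum_inv ls s \<longleftrightarrow> nvar s ''i'' \<le> length ls \<and>
     (\<exists>i. s = (initial ls)\<lparr>nvar := (nvar (initial ls))(''i'' := i),
        rvar := (rvar (initial ls))(''total'' := prefix_sum ls i)\<rparr>)"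

text \<open>In \<open>dominated\<close>, the first alternative bridges the removals from the back that precede the
  insertion of \<open>j\<close>.\<close>

definition dominated :: "real list \<Rightarrow> (nat \<Rightarrow> nat) \<Rightarrow> nat \<Rightarrow> nat \<Rightarrow> nat \<Rightarrow> nat \<Rightarrow> bool" where
  "dominated ls q h t j i \<longleftrightarrow>
     key ls j \<le> key ls i \<or> (\<exists>k. h \<le> k \<and> k < t \<and> i \<le> q k \<and> key ls (q k) \<le> key ls i)"

text \<open>Domination is demanded only from the front on: earlier positions cannot be optimal, as
  the front is admissible and later.\<close>

definition queue_ok :: "real list \<Rightarrow> (nat \<Rightarrow> nat) \<Rightarrow> nat \<Rightarrow> nat \<Rightarrow> nat \<Rightarrow> bool" where
  "queue_ok ls q h t j \<longleftrightarrow> 0 < j \<and> j \<le> length ls \<and> h < t \<and>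
     (\<forall>k. h \<le> k \<longrightarrow> k < t \<longrightarrow> q k < j) \<and>
     (\<forall>k l. h \<le> k \<longrightarrow> k < l \<longrightarrow> l < t \<longrightarrow> q k < q l \<and> key ls (q k) < key ls (q l)) \<and>
     key ls (q h) \<le> prefix_sum ls j \<and>
     (\<forall>i. q h \<le> i \<longrightarrow> i < j \<longrightarrow> dominated ls q h t j i)"

definition queue_inv :: "real list \<Rightarrow> state \<Rightarrow> bool" where
  "queue_inv ls s \<longleftrightarrow>
     queue_ok ls (narr s ''q'') (nvar s ''h'') (nvar s ''t'') (nvar s ''j'') \<and>
     nvar s ''n'' = length ls \<and>
     (\<forall>i < length ls. rarr s ''input'' i = ls ! i) \<and>
     (\<forall>i < nvar s ''j''. rarr s ''P'' i = prefix_sum ls i \<and> rarr s ''V'' i = key ls i) \<and>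
     rvar s ''x'' = prefix_sum ls (nvar s ''j'') \<and>
     rvar s ''total'' = prefix_sum ls (length ls) \<and>
     rvar s ''output'' = Min (wrap_bound ls ` {..<nvar s ''j''})"

text \<open>An amortizing potential: a removal shortens the queue by 1, while an insertion lengthens
  it by 1 but lowers the first summand by 2.\<close>

definition queue_measure :: "state \<Rightarrow> nat" where
  "queue_measure s = 2 * (nvar s ''n'' - nvar s ''j'') + (nvar s ''t'' - nvar s ''h'')"

section \<open>Queue operations and the queue invariant\<close>

lemma queue_ok_skip:
  assumes "queue_ok ls q h t j" "Suc h < t" "key ls (q (Suc h)) \<le> prefix_sum ls j"
  shows "queue_ok ls q (Suc h) t j"
proof -
  have "dominated ls q (Suc h) t j i" if i: "q (Suc h) \<le> i" "i < j" for i
  proof -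
    have "q h < q (Suc h)" using assms by (auto simp: queue_ok_def)
    with i assms(1) have "dominated ls q h t j i" by (auto simp: queue_ok_def)
    \<comment> \<open>The removed front lies before \<open>i\<close>, so it cannot be the dominating
      entry.\<close>
    with \<open>q h < q (Suc h)\<close> i show ?thesis
      unfolding dominated_def by (metis Suc_leI le_neq_implies_less leD order_trans)
  qed
  with assms show ?thesis by (auto simp: queue_ok_def)
qed

text \<open>Every position strictly between the front and \<open>j\<close> has a key at least that
  of \<open>j\<close> or of an entry behind the front. Both exceed the prefix sum at
  \<open>j\<close>, so the front is the largest admissible position.\<close>

lemma queue_ok_min_last:
  assumes "ruler ls" "queue_ok ls q h t j" "Suc h < t \<Longrightarrow> prefix_sum ls j < key ls (q (Suc h))"
  shows "min_last ls j = prefix_sum ls j - prefix_sum ls (q h)"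
proof (rule min_last_eq)
  fix i assume i: "q h < i" "i < j"
  then have "dominated ls q h t j i" using assms(2) by (auto simp: queue_ok_def)
  then show "prefix_sum ls j < key ls i"
    unfolding dominated_def
  proof (elim disjE exE conjE)
    assume "key ls j \<le> key ls i"
    then show ?thesis using prefix_sum_less_key[OF assms(1), of j] assms(2)
      by (auto simp: queue_ok_def)
  next
    fix k assume k: "h \<le> k" "k < t" "i \<le> q k" "key ls (q k) \<le> key ls i"
    with i have "h \<noteq> k" by auto
    with k have hk: "Suc h \<le> k" by simp
    have "key ls (q (Suc h)) \<le> key ls (q k)"
    proof (cases "Suc h = k")
      case False
      with hk k assms(2) show ?thesis
        by (metis le_SucI le_neq_implies_less less_imp_le order_refl queue_ok_def)
    qed simp
    with assms(3) hk k show ?thesis by force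
  qed
qed (use assms in \<open>auto simp: queue_ok_def\<close>)

text \<open>Whatever the removed back dominated is now dominated by \<open>j\<close>, through the
  first alternative. The second conclusion says that the front survives.\<close>

lemma queue_ok_pop:
  assumes "ruler ls" "queue_ok ls q h t j" "key ls j \<le> key ls (q (t - 1))"
  shows "queue_ok ls q h (t - 1) j" "Suc h < t"
proof -
  have "key ls (q h) < key ls j"
    using assms prefix_sum_less_key[OF assms(1), of j] by (auto simp: queue_ok_def)
  with assms(3) have "h \<noteq> t - 1" by auto
  with assms(2) show ht: "Suc h < t" by (auto simp: queue_ok_def)
  have "dominated ls q h (t - 1) j i" if i: "q h \<le> i" "i < j" for i
  proof -
    have "dominated ls q h t j i" using i assms by (auto simp: queue_ok_def)
    then show ?thesis
      unfolding dominated_def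
    proof (elim disjE exE conjE)
      fix k assume k: "h \<le> k" "k < t" "i \<le> q k" "key ls (q k) \<le> key ls i"
      show "key ls j \<le> key ls i \<or> (\<exists>k. h \<le> k \<and> k < t - 1 \<and> i \<le> q k \<and> key ls (q k) \<le> key ls i)"
      proof (cases "k = t - 1")
        case False
        with k have "k < t - 1" by simp
        with k show ?thesis by blast
      qed (use k assms(3) in auto)
    qed simp
  qed
  with assms ht show "queue_ok ls q h (t - 1) j" by (auto simp: queue_ok_def)
qed

text \<open>Domination by the pending \<open>j\<close> turns into domination by the new entry in
  slot \<open>t\<close>. The front stays admissible because prefix sums increase.\<close>

lemma queue_ok_push:
  assumes "ruler ls" "queue_ok ls q h t j" "key ls (q (t - 1)) < key ls j" "j < length ls"
  shows "queue_ok ls (q(t := j)) h (Suc t) (Suc j)"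
proof -
  let ?q = "q(t := j)"
  have ht: "h < t" using assms by (auto simp: queue_ok_def)
  have last: "key ls (q k) < key ls j" if "h \<le> k" "k < t" for k
  proof (cases "k = t - 1")
    case False
    with that have "k < t - 1" by simp
    with that assms(2) have "key ls (q k) < key ls (q (t - 1))" by (auto simp: queue_ok_def)
    with assms(3) show ?thesis by simp
  qed (use assms(3) in simp)
  have "dominated ls ?q h (Suc t) (Suc j) i" if i: "q h \<le> i" "i < Suc j" for i
  proof (cases "key ls j \<le> key ls i")
    case True
    with ht i show ?thesis by (auto simp: dominated_def intro!: exI[of _ t])
  next
    case False
    with i have "i < j" by (cases "i = j") auto
    with False i assms(2) obtain k where "h \<le> k" "k < t" "i \<le> q k" "key ls (q k) \<le> key ls i"
      by (auto simp: queue_ok_def dominated_def)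
    then show ?thesis by (auto simp: dominated_def intro!: exI[of _ k])
  qed
  moreover have "?q k < ?q l \<and> key ls (?q k) < key ls (?q l)" if "h \<le> k" "k < l" "l < Suc t" for k l
  proof (cases "l = t")
    case True
    with that last[of k] assms(2) show ?thesis by (simp add: queue_ok_def)
  next
    case False
    with that assms(2) show ?thesis by (simp add: queue_ok_def)
  qed
  moreover have "?q k < Suc j" if "h \<le> k" "k < Suc t" for k
    using that assms(2) by (cases "k = t") (simp_all add: queue_ok_def less_SucI)
  moreover have "key ls (q h) \<le> prefix_sum ls (Suc j)"
    using prefix_sum_less[OF assms(1), of j "Suc j"] assms(2,4) by (simp add: queue_ok_def)
  ultimately show ?thesis
    using assms(4) ht unfolding queue_ok_def by (simp add: Suc_le_eq)
qed

lemma queue_step: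
  assumes "ruler ls" "queue_inv ls s" "bval queue_test s"
  shows "queue_inv ls (effect queue_body s) \<and> queue_measure (effect queue_body s) < queue_measure s"
proof -
  let ?q = "narr s ''q''" and ?h = "nvar s ''h''" and ?t = "nvar s ''t''" and ?j = "nvar s ''j''"
  have ok: "queue_ok ls ?q ?h ?t ?j" and j: "?j < length ls"
    and n: "nvar s ''n'' = length ls"
    and arr: "\<And>i. i < ?j \<Longrightarrow> rarr s ''P'' i = prefix_sum ls i \<and> rarr s ''V'' i = key ls i"
    and x: "rvar s ''x'' = prefix_sum ls ?j"
    and input: "\<And>i. i < length ls \<Longrightarrow> rarr s ''input'' i = ls ! i"
    and total: "rvar s ''total'' = prefix_sum ls (length ls)"
    and out: "rvar s ''output'' = Min (wrap_bound ls ` {..<?j})"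
    using assms by (auto simp: queue_inv_def queue_test_def)
  have q: "?q k < ?j" if "?h \<le> k" "k < ?t" for k using ok that by (auto simp: queue_ok_def)
  have ht: "?h < ?t" using ok by (auto simp: queue_ok_def)
  have skip: "bval skip_test s \<longleftrightarrow> Suc ?h < ?t \<and> key ls (?q (Suc ?h)) \<le> prefix_sum ls ?j"
    using arr[OF q[of "Suc ?h"]] by (auto simp: skip_test_def x)
  show ?thesis
  proof (cases "bval skip_test s")
    case True
    with skip queue_ok_skip[OF ok] ht assms(2) show ?thesis
      by (auto simp: queue_body_def queue_inv_def queue_measure_def)
  next
    case False
    \<comment> \<open>The state after the assignment to \<open>v\<close>: once skipping stops, the
      front is optimal and yields the exact key of \<open>j\<close>.\<close>
    let ?s = "s\<lparr>rvar := (rvar s)(''v'' := key ls ?j)\<rparr>"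
    have g: "min_last ls ?j = prefix_sum ls ?j - prefix_sum ls (?q ?h)"
      using queue_ok_min_last[OF assms(1) ok] False skip by force
    have eff: "effect queue_body s =
        effect (Cond pop_test (NAssign ''t'' (NSub (NVar ''t'') (NConst 1))) push) ?s"
      using False arr[OF q[of ?h]] ht by (simp add: queue_body_def x key_def g)
    have pop: "bval pop_test ?s \<longleftrightarrow> key ls ?j \<le> key ls (?q (?t - 1))"
      using arr[OF q[of "?t - 1"]] ht by (auto simp: pop_test_def)
    show ?thesis
    proof (cases "bval pop_test ?s")
      case True
      with pop queue_ok_pop[OF assms(1) ok] assms(2) show ?thesis
        unfolding eff by (auto simp: queue_inv_def queue_measure_def)
    next
      case False
      have "{..<?j} \<noteq> {}" using ok by (auto simp: queue_ok_def)
      then have Min_Suc: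
        "Min (wrap_bound ls ` {..<Suc ?j}) = min (wrap_bound ls ?j) (Min (wrap_bound ls ` {..<?j}))"
        by (simp add: lessThan_Suc)
      have ok': "queue_ok ls (?q(?t := ?j)) ?h (Suc ?t) (Suc ?j)"
        using False pop queue_ok_push[OF assms(1) ok _ j] by simp
      let ?u = "effect push ?s"
      have vars: "nvar ?u = (nvar s)(''t'' := Suc ?t, ''j'' := Suc ?j)"
        by (simp add: push_def)
      have q': "narr ?u ''q'' = ?q(?t := ?j)" by (simp add: push_def)
      have arrs: "rarr ?u ''input'' = rarr s ''input''"
        "rarr ?u ''P'' = (rarr s ''P'')(?j := prefix_sum ls ?j)"
        "rarr ?u ''V'' = (rarr s ''V'')(?j := key ls ?j)"
        by (simp_all add: push_def x)
      have x': "rvar ?u ''x'' = prefix_sum ls (Suc ?j)"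
        using j input by (simp add: push_def x prefix_sum_Suc)
      have total': "rvar ?u ''total'' = rvar s ''total''" by (simp add: push_def)
      have out': "rvar ?u ''output'' = min (wrap_bound ls ?j) (rvar s ''output'')"
        by (simp add: push_def x total key_def wrap_bound_def min_def max_def)
      have "queue_inv ls ?u"
        using ok' arr n input total out
        by (simp add: queue_inv_def vars q' arrs x' total' out' Min_Suc less_Suc_eq)
      moreover have "queue_measure ?u < queue_measure s"
        using ht j n by (simp add: queue_measure_def vars)
      ultimately show ?thesis using False by (simp add: eff)
    qed
  qed
qed

lemma sum_step:
  assumes "sum_inv ls s" "bval sum_test s"
  shows "sum_inv ls (effect sum_body s) \<and>
    nvar (effect sum_body s) ''n'' - nvar (effect sum_body s) ''i'' < nvar s ''n'' - nvar s ''i''"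
proof -
  from assms obtain i where i: "i < length ls"
    and s: "s = (initial ls)\<lparr>nvar := (nvar (initial ls))(''i'' := i),
      rvar := (rvar (initial ls))(''total'' := prefix_sum ls i)\<rparr>"
    by (auto simp: sum_inv_def sum_test_def initial_def)
  have "effect sum_body s = (initial ls)\<lparr>nvar := (nvar (initial ls))(''i'' := Suc i),
      rvar := (rvar (initial ls))(''total'' := prefix_sum ls (Suc i))\<rparr>"
    using i by (simp add: s sum_body_def initial_def prefix_sum_Suc)
  with i show ?thesis by (auto simp: sum_inv_def s initial_def intro!: exI[of _ "Suc i"])
qed

lemma sum_inv_initial: "sum_inv ls (initial ls)"
  by (auto simp: sum_inv_def initial_def intro!: exI[of _ 0])

lemma queue_inv_start:
  assumes "ruler ls" "sum_inv ls s" "\<not> bval sum_test s"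
  shows "queue_inv ls (effect start s)" "queue_measure (effect start s) \<le> 2 * length ls"
proof -
  have len: "0 < length ls" using assms(1) by (auto simp: ruler_def)
  have s: "s = (initial ls)\<lparr>nvar := (nvar (initial ls))(''i'' := length ls),
      rvar := (rvar (initial ls))(''total'' := prefix_sum ls (length ls))\<rparr>"
    using assms(2,3) by (auto simp: sum_inv_def sum_test_def initial_def)
  have "prefix_sum ls (Suc 0) = ls ! 0" using len by (simp add: prefix_sum_Suc)
  \<comment> \<open>The first fact makes position 0 admissible for \<open>j = 1\<close>; the second
    evaluates the maximum in \<open>wrap_bound ls 0\<close>.\<close>
  moreover have "0 < prefix_sum ls (Suc 0)" "0 < prefix_sum ls (length ls)"
    using prefix_sum_less[OF assms(1), of 0 "Suc 0"] prefix_sum_less[OF assms(1) len] len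
    by simp_all
  moreover have "queue_ok ls (\<lambda>_. 0) 0 1 1"
    using len calculation(2) by (simp add: queue_ok_def dominated_def key_def Suc_le_eq)
  moreover have "{..<Suc 0} = {0}" by auto
  ultimately show "queue_inv ls (effect start s)"
    using len by (simp add: s start_def initial_def queue_inv_def wrap_bound_def key_def)
  show "queue_measure (effect start s) \<le> 2 * length ls"
    using len by (simp add: s start_def initial_def queue_measure_def del: length_greater_0_conv)
qed

section \<open>Total correctness and linear running time\<close>

definition wrap_time :: "nat \<Rightarrow> nat" where
  "wrap_time n =
     (n * (bcost sum_test + cost_bound sum_body + 1) + bcost sum_test + 1) + (cost_bound start +
     (2 * n * (bcost queue_test + cost_bound queue_body + 1) + bcost queue_test + 1))"

lemma wrap_prog_correct:
  assumes "ruler ls"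
  shows "\<exists>t s. exec wrap_prog (initial ls) t s \<and> t \<le> wrap_time (length ls) \<and> result_of s = W ls"
proof -
  have lf: "loop_free sum_body" "loop_free start" "loop_free queue_body"
    by (simp_all add: sum_body_def start_def queue_body_def push_def)
  from exec_While[of sum_body "sum_inv ls", OF lf(1) sum_inv_initial sum_step]
  obtain t1 s1 where 1: "exec (While sum_test sum_body) (initial ls) t1 s1"
    "sum_inv ls s1" "\<not> bval sum_test s1"
    "t1 \<le> (nvar (initial ls) ''n'' - nvar (initial ls) ''i'') *
       (bcost sum_test + cost_bound sum_body + 1) + bcost sum_test + 1"
    by blast
  obtain t2 where 2: "t2 \<le> cost_bound start" "exec start s1 t2 (effect start s1)"
    using exec_loop_free[OF lf(2)] by blast
  note inv = queue_inv_start[OF assms 1(2,3)]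
  from exec_While[of queue_body "queue_inv ls", OF lf(3) inv(1) queue_step[OF assms]]
  obtain t3 s3 where 3: "exec (While queue_test queue_body) (effect start s1) t3 s3"
    "queue_inv ls s3" "\<not> bval queue_test s3"
    "t3 \<le> queue_measure (effect start s1) * (bcost queue_test + cost_bound queue_body + 1) +
       bcost queue_test + 1"
    by blast
  have "exec wrap_prog (initial ls) (t1 + (t2 + t3)) s3"
    unfolding wrap_prog_def using 1(1) 2(2) 3(1) by (intro exec.Seq)
  moreover have "t1 + (t2 + t3) \<le> wrap_time (length ls)"
    unfolding wrap_time_def
  proof (intro add_mono)
    show "t1 \<le> length ls * (bcost sum_test + cost_bound sum_body + 1) + bcost sum_test + 1"
      using 1(4) by (simp add: initial_def)
    show "t3 \<le> 2 * length ls * (bcost queue_test + cost_bound queue_body + 1) + bcost queue_test + 1"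
      by (rule order_trans[OF 3(4)]) (intro add_mono mult_le_mono inv(2) order_refl)
  qed (rule 2(1))
  \<comment> \<open>The failed test and the invariant bound \<open>j\<close> from both sides, so
    \<open>output\<close> is the minimum over all positions.\<close>
  moreover have "nvar s3 ''j'' = length ls"
    using 3(2,3) by (auto simp: queue_inv_def queue_ok_def queue_test_def)
  then have "result_of s3 = W ls"
    using 3(2) by (simp add: queue_inv_def result_of_def W_eq[OF assms])
  ultimately show ?thesis by blast
qed

text \<open>The bound has the form \<open>n * a + b\<close>, which for \<open>n \<ge> 1\<close> is
  at most \<open>(a + b) * n\<close>, and \<open>a + b\<close> is
  \<open>wrap_time 1\<close>.\<close>

lemma wrap_time_linear: "(\<lambda>n. real (wrap_time n)) \<in> O(\<lambda>n. real n)"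
proof -
  have "wrap_time n \<le> wrap_time 1 * n" if "n \<ge> 1" for n
  proof -
    obtain a b where ab: "wrap_time = (\<lambda>n. n * a + b)"
    proof
      show "wrap_time = (\<lambda>n. n * ((bcost sum_test + cost_bound sum_body + 1) +
          2 * (bcost queue_test + cost_bound queue_body + 1)) +
          (bcost sum_test + 1 + cost_bound start + bcost queue_test + 1))"
        by (rule ext) (simp add: wrap_time_def algebra_simps)
    qed
    have "b \<le> b * n" using that by simp
    then show ?thesis by (simp add: ab algebra_simps)
  qed
  then have "\<forall>\<^sub>F n in sequentially. real (wrap_time n) \<le> real (wrap_time 1) * real n"
    by (intro eventually_sequentiallyI[of 1]) (metis of_nat_le_iff of_nat_mult)
  then show ?thesis by (intro bigoI[of _ "real (wrap_time 1)"]) simp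
qed

theorem theorem3:
  "\<exists>(prog :: com) (T :: nat \<Rightarrow> nat).
     (\<lambda>n. real (T n)) \<in> O(\<lambda>n. real n) \<and>
     (\<forall>ls :: real list. ruler ls \<longrightarrow>
        (\<exists>t s. exec prog (initial ls) t s \<and> t \<le> T (length ls) \<and> result_of s = W ls))"
  using wrap_time_linear wrap_prog_correct by blast

end
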